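(* Let $A$ and $B$ be nonempty finite subsets of an abelian group $G$, with $|A| = |B|$ and $1 \notin B$. Let $\lambda$ be the left partition number of $(A,B)$. Then $A$ can be written as a union of $\lambda$, and no fewer, pairwise disjoint left-admissible subsets.
   Context: The group $G$ is written multiplicatively with identity $1$. For $S \subseteq G$ and $x\in G$, $Sx = \{sx : s \in S\}$. A partial matching of $(A,B)$ is an injective map $f : A' \to B$, where $A' \subseteq A$, such that $a f(a) \notin A$ for all $a \in A'$ (the empty map is allowed). A subset $A' \subseteq A$ is left-admissible if it is the domain of some partial matching of $(A,B)$; in particular the empty set is left-admissible. For $S \subseteq A$ let $U_S = \{b \in B : Sb \subseteq A\}$. The assumptions $|A|=|B|$ and $1 \notin B$ guarantee that $U_S \neq B$ for every nonempty $S \subseteq A$. The left partition number $\lambda = \lambda(A,B)$ is the maximum value of $\left\lceil \frac{|S|}{|B| - |U_S|} \right\rceil$, where $S$ ranges over all nonempty subsets of $A$. *)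

theory Defs
  imports Complex_Main "HOL-Algebra.Coset" "HOL-Library.Disjoint_Sets"
begin

text \<open>A map \<open>f : A' \<rightarrow> B\<close> is a total function whose values off the domain \<open>A'\<close> are irrelevant;
  the domain is therefore an explicit argument.\<close>

definition partial_matching ::
    "('a, 'c) monoid_scheme \<Rightarrow> 'a set \<Rightarrow> 'a set \<Rightarrow> 'a set \<Rightarrow> ('a \<Rightarrow> 'a) \<Rightarrow> bool" where
  "partial_matching G A B A' f \<longleftrightarrow>
     A' \<subseteq> A \<and> f \<in> A' \<rightarrow> B \<and> inj_on f A' \<and> (\<forall>a\<in>A'. a \<otimes>\<^bsub>G\<^esub> f a \<notin> A)"

definition left_admissible ::
    "('a, 'c) monoid_scheme \<Rightarrow> 'a set \<Rightarrow> 'a set \<Rightarrow> 'a set \<Rightarrow> bool" where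
  "left_admissible G A B A' \<longleftrightarrow> (\<exists>f. partial_matching G A B A' f)"

definition left_U :: "('a, 'c) monoid_scheme \<Rightarrow> 'a set \<Rightarrow> 'a set \<Rightarrow> 'a set \<Rightarrow> 'a set" where
  "left_U G A B S = {b \<in> B. S #>\<^bsub>G\<^esub> b \<subseteq> A}"

text \<open>Meaningful when \<open>A\<close>, \<open>B\<close> are nonempty, finite, of equal cardinality and \<open>\<one> \<notin> B\<close>: then
  \<open>left_U G A B S\<close> is a proper subset of \<open>B\<close> for each nonempty \<open>S \<subseteq> A\<close>, so no denominator vanishes and
  every quotient is positive, and the maximum is over a nonempty finite set.\<close>

definition left_partition_number ::
    "('a, 'c) monoid_scheme \<Rightarrow> 'a set \<Rightarrow> 'a set \<Rightarrow> nat" where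
  "left_partition_number G A B =
     Max ((\<lambda>S. nat \<lceil>real (card S) / (real (card B) - real (card (left_U G A B S)))\<rceil>)
            ` {S. S \<subseteq> A \<and> S \<noteq> {}})"

text \<open>The members of \<open>P\<close> may include the empty set, which is left-admissible.\<close>

definition left_admissible_decomposition ::
    "('a, 'c) monoid_scheme \<Rightarrow> 'a set \<Rightarrow> 'a set \<Rightarrow> 'a set set \<Rightarrow> bool" where
  "left_admissible_decomposition G A B P \<longleftrightarrow>
     finite P \<and> disjoint P \<and> \<Union>P = A \<and> (\<forall>A'\<in>P. left_admissible G A B A')"

end

theory Submission imports Defs begin

text \<open>
  Join \<open>a \<in> A\<close> to \<open>b \<in> B\<close> when \<open>a b \<notin> A\<close>. Then \<open>B - U\<^sub>S\<close> is the neighbourhood of \<open>S\<close> and the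
  left-admissible sets are the subsets of \<open>A\<close> that can be matched into \<open>B\<close>. By Hall's theorem,
  applied after replacing every \<open>b \<in> B\<close> by \<open>k\<close> copies, \<open>A\<close> splits into at most \<open>k\<close> matchable sets
  iff \<open>|S| \<le> k |B - U\<^sub>S|\<close> for all \<open>S \<subseteq> A\<close>, that is, iff \<open>\<lambda> \<le> k\<close>.
\<close>

text \<open>Rado's argument: some element of a neighbourhood with at least two elements can be deleted
  without destroying Hall's condition.\<close>

theorem hall:
  assumes "finite I" "\<And>i. i \<in> I \<Longrightarrow> finite (N i)"
    and "\<And>J. J \<subseteq> I \<Longrightarrow> card J \<le> card (\<Union>(N ` J))"
  shows "\<exists>f. f \<in> Pi I N \<and> inj_on f I"
  using assms(2,3)
proof (induction "\<Sum>i\<in>I. card (N i)" arbitrary: N rule: less_induct)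
  case less
  note fin = less.prems(1) and hall = less.prems(2)
  show ?case
  proof (cases "\<forall>i\<in>I. card (N i) \<le> 1")
    case True
    have "card (N i) = 1" if "i \<in> I" for i
      using hall[of "{i}"] that True by force
    then have "\<forall>i\<in>I. \<exists>x. N i = {x}"
      by (simp add: card_1_singleton_iff)
    then obtain f where f: "\<And>i. i \<in> I \<Longrightarrow> N i = {f i}"
      by metis
    have "inj_on f I"
    proof (rule inj_onI, rule ccontr)
      fix i j assume ij: "i \<in> I" "j \<in> I" "f i = f j" "i \<noteq> j"
      then show False
        using hall[of "{i, j}"] f by simp
    qed
    then show ?thesis
      using f by (intro exI[of _ f]) auto
  next
    case False
    then obtain a where a: "a \<in> I" "\<not> card (N a) \<le> 1"
      by blast
    obtain x y where xy: "x \<in> N a" "y \<in> N a" "x \<noteq> y"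
      using a fin by (metis One_nat_def card_le_Suc0_iff_eq)
    \<comment> \<open>Delete \<open>z\<close> from \<open>N a\<close>. If Hall's condition survives,
      induction on the total size gives \<open>f\<close>. Otherwise some \<open>J\<close> violates
      it. \<open>J\<close> contains \<open>a\<close>, as its neighbourhood would be unchanged
      otherwise, and removing \<open>a\<close> from \<open>J\<close> turns the strict inequality
      into the weak one for \<open>S = J - {a}\<close>.\<close>
    have step: "(\<exists>f. f \<in> Pi I N \<and> inj_on f I) \<or>
        (\<exists>S \<subseteq> I - {a}. card (\<Union>(N ` S) \<union> (N a - {z})) \<le> card S)" if z: "z \<in> N a" for z
    proof (cases "\<forall>J \<subseteq> I. card J \<le> card (\<Union>((N(a := N a - {z})) ` J))")
      case True
      have "card (N a - {z}) < card (N a)"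
        using fin a z by (meson card_Diff1_less)
      then have "(\<Sum>i\<in>I. card ((N(a := N a - {z})) i)) < (\<Sum>i\<in>I. card (N i))"
        using a(1) assms(1) by (intro sum_strict_mono_ex1) auto
      then obtain f where "f \<in> Pi I (N(a := N a - {z}))" "inj_on f I"
        using less.hyps[of "N(a := N a - {z})"] True fin by force
      then show ?thesis
        by (intro disjI1 exI[of _ f]) (auto simp: Pi_iff split: if_splits)
    next
      case False
      then obtain J where J: "J \<subseteq> I" "card (\<Union>((N(a := N a - {z})) ` J)) < card J"
        by (auto simp: not_le)
      have "a \<in> J"
      proof (rule ccontr)
        assume "a \<notin> J"
        then have "(N(a := N a - {z})) ` J = N ` J"
          by (intro image_cong) auto
        then show False
          using J hall[of J] by simp
      qed
      moreover have "(N(a := N a - {z})) ` (J - {a}) = N ` (J - {a})"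
        by (intro image_cong) auto
      ultimately have "\<Union>((N(a := N a - {z})) ` J) = \<Union>(N ` (J - {a})) \<union> (N a - {z})"
        by (metis Un_commute Union_insert fun_upd_same image_insert insert_Diff)
      moreover have "card J = Suc (card (J - {a}))"
        using \<open>a \<in> J\<close> J(1) assms(1) by (metis card.remove finite_subset)
      ultimately show ?thesis
        using J by (intro disjI2 exI[of _ "J - {a}"]) auto
    qed
    show ?thesis
    proof (rule ccontr)
      assume no: "\<not> ?thesis"
      obtain S where S: "S \<subseteq> I - {a}" "card (\<Union>(N ` S) \<union> (N a - {x})) \<le> card S"
        using step[OF xy(1)] no by blast
      obtain T where T: "T \<subseteq> I - {a}" "card (\<Union>(N ` T) \<union> (N a - {y})) \<le> card T"
        using step[OF xy(2)] no by blast
      \<comment> \<open>Submodular count: since \<open>x \<noteq> y\<close>,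
        \<open>?X \<union> ?Y\<close> contains all of \<open>N a\<close>, so Hall's condition for
        \<open>insert a (S \<union> T)\<close> and for \<open>S \<inter> T\<close> adds up to |S| +
        |T| + 1 \<le> |?X| + |?Y|, whereas the choice of \<open>S\<close> and \<open>T\<close> gives
        |?X| + |?Y| \<le> |S| + |T|.\<close>
      let ?X = "\<Union>(N ` S) \<union> (N a - {x})" and ?Y = "\<Union>(N ` T) \<union> (N a - {y})"
      have finST: "finite S" "finite T"
        using S T assms(1) finite_subset by blast+
      have finXY: "finite ?X" "finite ?Y"
        using S(1) T(1) finST a(1) fin by auto
      have "card (insert a (S \<union> T)) \<le> card (\<Union>(N ` insert a (S \<union> T)))"
        using S T a by (intro hall) auto
      also have "\<dots> \<le> card (?X \<union> ?Y)"
        using finXY xy by (intro card_mono) auto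
      finally have "Suc (card (S \<union> T)) \<le> card (?X \<union> ?Y)"
        using S(1) T(1) finST by (subst (asm) card_insert_disjoint) auto
      moreover have "card (S \<inter> T) \<le> card (?X \<inter> ?Y)"
      proof -
        have "card (S \<inter> T) \<le> card (\<Union>(N ` (S \<inter> T)))"
          using S by (intro hall) auto
        also have "\<dots> \<le> card (?X \<inter> ?Y)"
          using finXY by (intro card_mono) auto
        finally show ?thesis .
      qed
      ultimately show False
        using S(2) T(2) card_Un_Int[OF finXY] card_Un_Int[OF finST] by linarith
    qed
  qed
qed

lemma Diff_left_U:
  "B - left_U G A B S = (\<Union>a\<in>S. {b \<in> B. a \<otimes>\<^bsub>G\<^esub> b \<notin> A})"
  by (auto simp: left_U_def r_coset_def)

lemma card_Diff_left_U:
  assumes "finite B"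
  shows "card (B - left_U G A B S) = card B - card (left_U G A B S)"
    and "card (left_U G A B S) \<le> card B"
proof -
  have "left_U G A B S \<subseteq> B"
    by (auto simp: left_U_def)
  then show "card (B - left_U G A B S) = card B - card (left_U G A B S)"
    and "card (left_U G A B S) \<le> card B"
    using assms by (auto intro: card_Diff_subset card_mono finite_subset)
qed

text \<open>Otherwise, for \<open>s \<in> S\<close>, translation by \<open>s\<close> maps
  \<open>B\<close> injectively into \<open>A\<close>, hence onto \<open>A\<close> by equal
  cardinality. Then \<open>s\<close> itself is \<open>s \<otimes> b\<close> with
  \<open>b \<in> B\<close>, which forces \<open>b = \<one>\<close>. This keeps the denominators in
  the partition number positive.\<close>

lemma (in group) left_U_neq:
  assumes "A \<subseteq> carrier G" "B \<subseteq> carrier G" "finite A" "card A = card B" "\<one> \<notin> B"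
    and "S \<subseteq> A" "S \<noteq> {}"
  shows "left_U G A B S \<noteq> B"
proof
  assume U: "left_U G A B S = B"
  obtain s where s: "s \<in> S"
    using assms by blast
  have sG: "s \<in> carrier G"
    using s assms by blast
  have "inj_on ((\<otimes>) s) B"
    using inj_on_cmult[OF sG] assms(2) by (rule inj_on_subset)
  then have "card ((\<otimes>) s ` B) = card A"
    using assms(4) by (simp add: card_image)
  moreover have "(\<otimes>) s ` B \<subseteq> A"
    using U s by (auto simp: left_U_def r_coset_def)
  ultimately have "(\<otimes>) s ` B = A"
    using assms(3) by (simp add: card_subset_eq)
  then obtain b where "b \<in> B" "s = s \<otimes> b"
    using s assms(6) by blast
  then have "b = \<one>"
    using sG assms(2) by (metis l_cancel_one' subsetD)
  then show False
    using \<open>b \<in> B\<close> assms(5) by simp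
qed

text \<open>A maximum of rounded-up quotients is at most the integer \<open>k\<close> iff each
  quotient is, and the positive denominators can be cleared. This turns the partition number into
  Hall's condition with \<open>k\<close> copies.\<close>

lemma (in group) left_partition_number_le_iff:
  assumes "A \<subseteq> carrier G" "B \<subseteq> carrier G" "finite A" "finite B" "A \<noteq> {}"
    and "card A = card B" "\<one> \<notin> B"
  shows "left_partition_number G A B \<le> k \<longleftrightarrow>
    (\<forall>S \<subseteq> A. card S \<le> k * card (B - left_U G A B S))"
proof -
  have "nat \<lceil>real (card S) / (real (card B) - real (card (left_U G A B S)))\<rceil> \<le> k \<longleftrightarrow>
      card S \<le> k * card (B - left_U G A B S)" if S: "S \<subseteq> A" "S \<noteq> {}" for S
  proof -
    have "B - left_U G A B S \<noteq> {}"
      using left_U_neq[OF assms(1,2,3,6,7) S] by (auto simp: left_U_def)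
    then have pos: "0 < real (card (B - left_U G A B S))"
      using assms(4) by (simp add: card_gt_0_iff)
    have "nat \<lceil>real (card S) / (real (card B) - real (card (left_U G A B S)))\<rceil> \<le> k \<longleftrightarrow>
        real (card S) / real (card (B - left_U G A B S)) \<le> real k"
      using card_Diff_left_U[OF assms(4), of G A S]
      by (simp add: of_nat_diff nat_le_iff ceiling_le_iff)
    also have "\<dots> \<longleftrightarrow> real (card S) \<le> real (k * card (B - left_U G A B S))"
      using pos by (simp add: pos_divide_le_eq)
    finally show ?thesis
      by (simp only: of_nat_le_iff)
  qed
  then have *: "\<forall>S\<in>{S. S \<subseteq> A \<and> S \<noteq> {}}.
      nat \<lceil>real (card S) / (real (card B) - real (card (left_U G A B S)))\<rceil> \<le> k \<longleftrightarrow>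
      card S \<le> k * card (B - left_U G A B S)"
    by blast
  have "finite {S. S \<subseteq> A \<and> S \<noteq> {}}" "{S. S \<subseteq> A \<and> S \<noteq> {}} \<noteq> {}"
    using assms(3,5) by auto
  then have "left_partition_number G A B \<le> k \<longleftrightarrow>
      (\<forall>S\<in>{S. S \<subseteq> A \<and> S \<noteq> {}}. card S \<le> k * card (B - left_U G A B S))"
    unfolding left_partition_number_def using * by (subst Max_le_iff) auto
  then show ?thesis
    \<comment> \<open>The maximum ranges over nonempty \<open>S\<close> only; for empty
      \<open>S\<close> the inequality is trivial.\<close>
    by (metis (mono_tags, lifting) card.empty le0 mem_Collect_eq)
qed

text \<open>The matching of each member \<open>X\<close> of \<open>P\<close> sends
  \<open>S \<inter> X\<close> injectively into the neighbourhood of \<open>S\<close>; summing over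
  \<open>P\<close> bounds |S|.\<close>

lemma card_le_if_left_admissible_decomposition:
  assumes "left_admissible_decomposition G A B P" "finite A" "finite B" "S \<subseteq> A"
  shows "card S \<le> card P * card (B - left_U G A B S)"
proof -
  have P: "finite P" "disjoint P" "\<Union>P = A" "\<And>X. X \<in> P \<Longrightarrow> left_admissible G A B X"
    using assms(1) by (auto simp: left_admissible_decomposition_def)
  have "card (S \<inter> X) \<le> card (B - left_U G A B S)" if X: "X \<in> P" for X
  proof -
    obtain f where f: "partial_matching G A B X f"
      using P(4)[OF X] by (auto simp: left_admissible_def)
    have "inj_on f (S \<inter> X)"
      using f by (auto simp: partial_matching_def intro: inj_on_subset)
    moreover have "f ` (S \<inter> X) \<subseteq> B - left_U G A B S"
      using f by (auto simp: partial_matching_def Diff_left_U)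
    ultimately show ?thesis
      using assms(3) by (intro card_inj_on_le) auto
  qed
  then have "(\<Sum>X\<in>P. card (S \<inter> X)) \<le> card P * card (B - left_U G A B S)"
    using sum_bounded_above[of P "\<lambda>X. card (S \<inter> X)"] by simp
  moreover have "S = (\<Union>X\<in>P. S \<inter> X)"
    using P(3) assms(4) by blast
  then have "card S \<le> (\<Sum>X\<in>P. card (S \<inter> X))"
    using card_UN_le[OF P(1)] by metis
  ultimately show ?thesis
    by linarith
qed

lemma ex_left_admissible_decomposition:
  assumes "finite A" "finite B"
    and "\<And>S. S \<subseteq> A \<Longrightarrow> card S \<le> k * card (B - left_U G A B S)"
  shows "\<exists>P. left_admissible_decomposition G A B P \<and> card P \<le> k"
proof -
  \<comment> \<open>The second coordinate numbers the \<open>k\<close> copies of each element of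
    \<open>B\<close>.\<close>
  define N where "N a = {b \<in> B. a \<otimes>\<^bsub>G\<^esub> b \<notin> A} \<times> {..<k}" for a
  have "\<Union>(N ` S) = (B - left_U G A B S) \<times> {..<k}" for S
    by (auto simp: N_def Diff_left_U)
  then have "card S \<le> card (\<Union>(N ` S))" if "S \<subseteq> A" for S
    using assms(3)[OF that] by (simp add: card_cartesian_product mult.commute)
  then obtain g where g: "g \<in> Pi A N" "inj_on g A"
    using hall[of A N] assms(1,2) by (auto simp: N_def)
  \<comment> \<open>These are the elements matched into copy \<open>i\<close>. On such a fibre
    \<open>snd (g a)\<close> is constant, so injectivity of \<open>g\<close> passes to its first
    coordinate.\<close>
  define part where "part i = {a \<in> A. snd (g a) = i}" for i
  have "left_admissible G A B (part i)" for i
  proof -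
    have "inj_on (\<lambda>a. fst (g a)) (part i)"
      using g(2) by (auto simp: part_def inj_on_def prod_eq_iff)
    then have "partial_matching G A B (part i) (\<lambda>a. fst (g a))"
      using g(1) by (force simp: partial_matching_def part_def N_def Pi_iff)
    then show ?thesis
      by (auto simp: left_admissible_def)
  qed
  moreover have "disjoint (part ` {..<k})"
    by (auto simp: disjoint_def part_def)
  moreover have "\<Union>(part ` {..<k}) = A"
    using g(1) by (fastforce simp: part_def N_def Pi_iff)
  ultimately have "left_admissible_decomposition G A B (part ` {..<k})"
    by (auto simp: left_admissible_decomposition_def)
  \<comment> \<open>Only an upper bound, because several empty parts collapse to one member of the
    set.\<close>
  moreover have "card (part ` {..<k}) \<le> k"
    using card_image_le[of "{..<k}" part] by simp
  ultimately show ?thesis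
    by blast
qed

theorem theorem5p6:
  fixes G :: "('a, 'c) monoid_scheme" and A B :: "'a set"
  assumes "comm_group G"
    and "A \<subseteq> carrier G" and "B \<subseteq> carrier G"
    and "finite A" and "finite B"
    and "A \<noteq> {}" and "B \<noteq> {}"
    and "card A = card B"
    and "\<one>\<^bsub>G\<^esub> \<notin> B"
  shows "(\<exists>P. left_admissible_decomposition G A B P \<and> card P = left_partition_number G A B)
       \<and> (\<forall>P. left_admissible_decomposition G A B P \<longrightarrow> left_partition_number G A B \<le> card P)"
proof -
  interpret comm_group G by fact
  note iff = left_partition_number_le_iff[OF assms(2-6,8,9)]
  have lower: "left_partition_number G A B \<le> card P" if "left_admissible_decomposition G A B P" for P
    using card_le_if_left_admissible_decomposition[OF that assms(4,5)] by (simp add: iff)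
  obtain P where "left_admissible_decomposition G A B P" "card P \<le> left_partition_number G A B"
    using ex_left_admissible_decomposition[OF assms(4,5)] iff by blast
  \<comment> \<open>\<open>P\<close> comes from taking \<open>k\<close> to be the partition number;
    \<open>lower\<close> excludes fewer members, so its cardinality is exact.\<close>
  then show ?thesis
    using lower by (meson le_antisym)
qed

end
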